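(* Let $f:\mathbb{R}\to\mathbb{R}$ be a continuous function such that $f(x+\pi)=f(x)$ and $f(\pi-x)=f(x)$ for all $0\le x<\infty$. If the integral $\int_0^\infty \frac{\sin^4 x}{x^4}f(x)\,dx$ is defined in the sense of the improper Riemann integral, then $$\int_0^\infty \frac{\sin^4 x}{x^4}f(x)\,dx=\int_0^{\pi/2} f(t)\,dt-\frac{2}{3}\int_0^{\pi/2}\sin^2 t\, f(t)\,dt.$$
   Context: The integrand $\frac{\sin^4 x}{x^4}$ is understood to take its limiting value $1$ at $x=0$. *)

theory Defs
  imports "HOL-Analysis.Henstock_Kurzweil_Integration"
begin

text \<open>
  The library's \<^const>\<open>integral\<close> is the Henstock--Kurzweil integral, whose gauge may depend on
  the tag.  The Riemann integral asks for convergence of the tagged sums as the mesh, a single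
  number, tends to zero.
\<close>

definition has_riemann_integral :: "(real \<Rightarrow> real) \<Rightarrow> real \<Rightarrow> real \<Rightarrow> real \<Rightarrow> bool" where
  "has_riemann_integral g a b I \<longleftrightarrow>
     (\<forall>e>0. \<exists>d>0. \<forall>p. p tagged_division_of {a..b} \<and> (\<forall>(x, K)\<in>p. content K < d) \<longrightarrow>
        \<bar>(\<Sum>(x, K)\<in>p. content K * g x) - I\<bar> < e)"

definition riemann_integrable :: "(real \<Rightarrow> real) \<Rightarrow> real \<Rightarrow> real \<Rightarrow> bool" where
  "riemann_integrable g a b \<longleftrightarrow> (\<exists>I. has_riemann_integral g a b I)"

lemma has_riemann_integral_imp_has_integral:
  assumes "has_riemann_integral g a b I"
  shows "(g has_integral I) {a..b}"
proof -
  have "\<exists>\<gamma>. gauge \<gamma> \<and> (\<forall>p. p tagged_division_of cbox a b \<and> \<gamma> fine p \<longrightarrow>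
          norm ((\<Sum>(x, K)\<in>p. content K *\<^sub>R g x) - I) < e)" if "e > 0" for e
  proof -
    obtain d where d: "d > 0"
      and *: "\<And>p. \<lbrakk>p tagged_division_of {a..b}; \<forall>(x, K)\<in>p. content K < d\<rbrakk> \<Longrightarrow>
        \<bar>(\<Sum>(x, K)\<in>p. content K * g x) - I\<bar> < e"
      using assms \<open>e > 0\<close> unfolding has_riemann_integral_def by meson
    have "content K < d"
      if p: "p tagged_division_of {a..b}" "(\<lambda>x. ball x (d/2)) fine p" "(x, K) \<in> p" for p x K
    proof -
      obtain u v where K: "K = {u..v}"
        using tagged_division_ofD(4)[OF p(1,3)] by (auto simp: cbox_interval)
      have "x \<in> K" using tagged_division_ofD(2)[OF p(1,3)] .
      then have "u \<le> v" using K by auto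
      moreover have "K \<subseteq> ball x (d/2)" using p(2,3) by (auto simp: fine_def)
      ultimately have "dist x u < d/2" "dist x v < d/2" using K by auto
      then have "v - u < d" unfolding dist_real_def by linarith
      then show ?thesis using K \<open>u \<le> v\<close> by simp
    qed
    then have "\<bar>(\<Sum>(x, K)\<in>p. content K * g x) - I\<bar> < e"
      if "p tagged_division_of {a..b}" "(\<lambda>x. ball x (d/2)) fine p" for p
      using *[OF that(1)] that by fast
    then show ?thesis
      using d by (intro exI[of _ "\<lambda>x. ball x (d/2)"]) (simp add: cbox_interval gauge_def)
  qed
  then show ?thesis
    unfolding cbox_interval[symmetric] has_integral by blast
qed

text \<open>
  By the preceding lemma, \<^term>\<open>integral {a..T} g\<close> is the value of the Riemann integral
  whenever \<^term>\<open>riemann_integrable g a T\<close>.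
\<close>

definition has_improper_riemann_integral :: "(real \<Rightarrow> real) \<Rightarrow> real \<Rightarrow> real \<Rightarrow> bool" where
  "has_improper_riemann_integral g a L \<longleftrightarrow>
     (\<forall>T\<ge>a. riemann_integrable g a T) \<and> ((\<lambda>T. integral {a..T} g) \<longlongrightarrow> L) at_top"

definition improper_riemann_integrable :: "(real \<Rightarrow> real) \<Rightarrow> real \<Rightarrow> bool" where
  "improper_riemann_integrable g a \<longleftrightarrow> (\<exists>L. has_improper_riemann_integral g a L)"

definition improper_riemann_integral :: "(real \<Rightarrow> real) \<Rightarrow> real \<Rightarrow> real" where
  "improper_riemann_integral g a = (THE L. has_improper_riemann_integral g a L)"

lemma improper_riemann_integral_eqI:
  assumes "has_improper_riemann_integral g a L"
  shows "improper_riemann_integral g a = L"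
  unfolding improper_riemann_integral_def
proof (rule the_equality)
  show "has_improper_riemann_integral g a L" by fact
next
  fix L' assume "has_improper_riemann_integral g a L'"
  then have "((\<lambda>T. integral {a..T} g) \<longlongrightarrow> L') at_top"
    and "((\<lambda>T. integral {a..T} g) \<longlongrightarrow> L) at_top"
    using assms by (simp_all add: has_improper_riemann_integral_def)
  then show "L' = L"
    by (rule tendsto_unique[OF trivial_limit_at_top_linorder])
qed

end

theory Submission
  imports Defs "HOL-Analysis.Analysis"
begin

text \<open>
  The symmetries of \<open>f\<close> fold \<open>[0, N\<pi>]\<close> onto \<open>[0, \<pi>/2]\<close>, turning the kernel into the first \<open>N\<close>
  pairs of terms of \<open>sin\<^sup>4 t \<cdot> (\<Sum>k\<in>\<int>. 1/(t + k\<pi>)\<^sup>4)\<close>.  By the Weierstrass M-test these sums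
  converge uniformly, and the partial fraction expansion
  \<open>(\<Sum>k\<in>\<int>. 1/(t + k\<pi>)\<^sup>4) = 1/sin\<^sup>4 t - (2/3)/sin\<^sup>2 t\<close> identifies the limit kernel as
  \<open>1 - (2/3) sin\<^sup>2 t\<close>.  The expansion is proved by Herglotz's trick: the difference \<open>h\<close> of the two
  sides satisfies \<open>h(t/2) + h(t/2 + \<pi>/2) = 16 h(t)\<close>, and \<open>h(t) sin\<^sup>2 t\<close> is bounded, so each
  application of the functional equation improves the bound by a factor of \<open>4\<close>.
\<close>

section \<open>Ingredients of Herglotz's trick: a bound near the pole at 0 and a dyadic
  iteration\<close>

lemma sin_ge_cubic:
  fixes x :: real
  assumes "0 \<le> x"
  shows "x - x ^ 3 / 6 \<le> sin x"
proof -
  have "\<bar>sin x - (\<Sum>m<3. sin_coeff m * x ^ m)\<bar> \<le> inverse (fact 3) * \<bar>x\<bar> ^ 3"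
    by (rule Maclaurin_sin_bound)
  moreover have "(\<Sum>m<3. sin_coeff m * x ^ m) = x"
    by (simp add: eval_nat_numeral sin_coeff_def)
  moreover have "inverse (fact 3) * \<bar>x\<bar> ^ 3 = x ^ 3 / 6"
    using assms by (simp add: fact_numeral)
  ultimately show ?thesis
    by linarith
qed

text \<open>This controls the pole at 0 in the boundedness half of Herglotz's trick. Both terms grow
  like \<open>1 / t^2\<close>, but \<open>t^4 - sin^4 t\<close> is of order \<open>t^6\<close>, so
  the growth cancels. The constant is \<open>2/3 * 9\<close>, where 9 comes from
  \<open>t / sin t \<le> 3\<close>.\<close>

lemma csc_squared_minus_bounded:
  fixes t :: real
  assumes "0 < t" "t \<le> pi / 2"
  shows "\<bar>1 / (sin t)\<^sup>2 - (sin t)\<^sup>2 / t ^ 4\<bar> \<le> 6"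
proof -
  let ?s = "sin t"
  have s: "0 < ?s" "?s \<le> t"
    using assms by (auto intro: sin_gt_zero sin_x_le_x)
  have d: "t - ?s \<le> t ^ 3 / 6"
    using sin_ge_cubic[of t] assms by linarith
  \<comment> \<open>Since \<open>t < 2\<close>, the cubic error \<open>t^3 / 6\<close> is at most
    \<open>2 * t / 3\<close>, which leaves \<open>sin t \<ge> t / 3\<close>.\<close>
  have "t * t \<le> 2 * 2"
    using assms pi_half_less_two by (intro mult_mono) auto
  then have "t * (t * t) \<le> t * (2 * 2)"
    using assms by (intro mult_left_mono) auto
  then have "t / 3 \<le> ?s"
    using d by (simp add: power3_eq_cube)
  then have "(t / 3)\<^sup>2 \<le> ?s\<^sup>2"
    using assms by (intro power_mono) auto
  then have t2: "t\<^sup>2 / ?s\<^sup>2 \<le> 9"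
    using s by (simp add: field_simps)
  have "t ^ 4 - ?s ^ 4 = (t - ?s) * ((t + ?s) * (t\<^sup>2 + ?s\<^sup>2))"
    by (simp add: algebra_simps power2_eq_square power4_eq_xxxx)
  also have "\<dots> \<le> t ^ 3 / 6 * ((t + t) * (t\<^sup>2 + t\<^sup>2))"
    using s d by (intro mult_mono add_mono power_mono) auto
  also have "\<dots> = 2 / 3 * t ^ 6"
    by (simp add: eval_nat_numeral)
  finally have num: "t ^ 4 - ?s ^ 4 \<le> 2 / 3 * t ^ 6" .
  have eq: "1 / ?s\<^sup>2 - ?s\<^sup>2 / t ^ 4 = (t ^ 4 - ?s ^ 4) / (t ^ 4 * ?s\<^sup>2)"
    using s by (simp add: field_simps flip: power_add)
  also have "\<dots> \<le> (2 / 3 * t ^ 6) / (t ^ 4 * ?s\<^sup>2)"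
    using num by (intro divide_right_mono) auto
  also have "\<dots> = 2 / 3 * (t\<^sup>2 / ?s\<^sup>2)"
    using s by (simp add: field_simps flip: power_add)
  also have "\<dots> \<le> 6"
    using t2 by simp
  finally have "1 / ?s\<^sup>2 - ?s\<^sup>2 / t ^ 4 \<le> 6" .
  moreover have "?s ^ 4 \<le> t ^ 4"
    using s by (intro power_mono) auto
  then have "0 \<le> 1 / ?s\<^sup>2 - ?s\<^sup>2 / t ^ 4"
    unfolding eq by (intro divide_nonneg_nonneg) auto
  ultimately show ?thesis
    by simp
qed

text \<open>The weight fits the halving: \<open>sin^2 t = 4 s^2 c^2\<close> with
  \<open>s = sin (t/2)\<close> and \<open>c = cos (t/2) = sin (t/2 + pi/2)\<close>. After
  multiplication by \<open>s^2 c^2\<close> each value of \<open>h\<close> on the left meets its own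
  weight, the leftover factors add up to \<open>c^2 + s^2 = 1\<close>, and
  \<open>16 s^2 c^2 = 4 sin^2 t\<close> yields the gain. Both new arguments stay in the open
  interval, so the bound can be iterated.\<close>

lemma dyadic_functional_equation_imp_zero:
  fixes h :: "real \<Rightarrow> real"
  assumes dup: "\<And>t. 0 < t \<Longrightarrow> t < pi \<Longrightarrow> h (t / 2) + h (t / 2 + pi / 2) = 16 * h t"
    and bound: "\<And>t. 0 < t \<Longrightarrow> t < pi \<Longrightarrow> \<bar>h t\<bar> * (sin t)\<^sup>2 \<le> M"
    and t: "0 < t" "t < pi"
  shows "h t = 0"
proof -
  have iter: "\<bar>h t\<bar> * (sin t)\<^sup>2 \<le> M * (1 / 4) ^ n" if "0 < t" "t < pi" for n t
    using that
  proof (induction n arbitrary: t)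
    case 0
    then show ?case using bound by simp
  next
    case (Suc n)
    let ?B = "M * (1 / 4) ^ n" and ?s = "sin (t / 2)" and ?c = "cos (t / 2)"
    have sin_c: "sin (t / 2 + pi / 2) = ?c"
      by (simp add: sin_add)
    have s2: "sin t = 2 * ?s * ?c"
      using sin_double[of "t / 2"] by simp
    have 1: "\<bar>h (t / 2)\<bar> * ?s\<^sup>2 \<le> ?B"
      using Suc.IH[of "t / 2"] Suc.prems by simp
    have 2: "\<bar>h (t / 2 + pi / 2)\<bar> * ?c\<^sup>2 \<le> ?B"
      using Suc.IH[of "t / 2 + pi / 2"] Suc.prems by (simp add: sin_c)
    have "16 * \<bar>h t\<bar> \<le> \<bar>h (t / 2)\<bar> + \<bar>h (t / 2 + pi / 2)\<bar>"
      using dup[OF Suc.prems] by linarith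
    then have "16 * \<bar>h t\<bar> * (?s\<^sup>2 * ?c\<^sup>2) \<le> (\<bar>h (t / 2)\<bar> + \<bar>h (t / 2 + pi / 2)\<bar>) * (?s\<^sup>2 * ?c\<^sup>2)"
      by (rule mult_right_mono) simp
    also have "\<dots> = (\<bar>h (t / 2)\<bar> * ?s\<^sup>2) * ?c\<^sup>2 + (\<bar>h (t / 2 + pi / 2)\<bar> * ?c\<^sup>2) * ?s\<^sup>2"
      by (simp add: algebra_simps)
    also have "\<dots> \<le> ?B * ?c\<^sup>2 + ?B * ?s\<^sup>2"
      by (intro add_mono mult_right_mono 1 2) auto
    also have "\<dots> = ?B"
      by (simp flip: distrib_left)
    finally have "16 * \<bar>h t\<bar> * (?s\<^sup>2 * ?c\<^sup>2) \<le> ?B" .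
    then show ?case
      by (simp add: s2 power_mult_distrib algebra_simps)
  qed
  have "(\<lambda>n. M * (1 / 4) ^ n) \<longlonglongrightarrow> M * 0"
    by (intro tendsto_mult tendsto_const LIMSEQ_power_zero) simp
  then have "\<bar>h t\<bar> * (sin t)\<^sup>2 \<le> 0"
    using iter[OF t] by (intro Lim_bounded2[where f = "\<lambda>n. M * (1 / 4) ^ n" and N = 0]) auto
  moreover have "0 < (sin t)\<^sup>2"
    using sin_gt_zero[OF t] by simp
  ultimately show ?thesis
    by (simp add: mult_le_0_iff)
qed

section \<open>The bilateral series of fourth-power poles and its closed form\<close>

text \<open>
  The pole at \<open>(k + 1)\<pi>\<close> stands for the index \<open>-(k + 1)\<close> of the bilateral series, so that
  \<open>k \<ge> 0\<close> runs through all integers.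
\<close>

definition shifted_pole_pair :: "nat \<Rightarrow> real \<Rightarrow> real" where
  "shifted_pole_pair k t = 1 / (t + real k * pi) ^ 4 + 1 / (real (Suc k) * pi - t) ^ 4"

text \<open>Only the pair of index 0 has poles in \<open>[0, pi]\<close>, namely at the two
  endpoints; from index 1 on the poles keep a distance of at least the index, which gives a majorant
  independent of \<open>t\<close>.\<close>

lemma shifted_pole_pair_Suc_bound:
  assumes "0 \<le> t" "t \<le> pi"
  shows "0 \<le> shifted_pole_pair (Suc k) t" "shifted_pole_pair (Suc k) t \<le> 2 / real (Suc k) ^ 4"
proof -
  show "0 \<le> shifted_pole_pair (Suc k) t"
    by (simp add: shifted_pole_pair_def)
  have pi1: "real (Suc k) * 1 \<le> real (Suc k) * pi"
    using pi_ge_two by (intro mult_left_mono) auto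
  have "real (Suc k) \<le> t + real (Suc k) * pi" "real (Suc k) \<le> real (Suc (Suc k)) * pi - t"
    using assms pi1 by (auto simp: algebra_simps)
  then have "1 / (t + real (Suc k) * pi) ^ 4 \<le> 1 / real (Suc k) ^ 4"
    "1 / (real (Suc (Suc k)) * pi - t) ^ 4 \<le> 1 / real (Suc k) ^ 4"
    by (intro divide_left_mono power_mono mult_pos_pos zero_less_power; linarith)+
  then show "shifted_pole_pair (Suc k) t \<le> 2 / real (Suc k) ^ 4"
    by (simp add: shifted_pole_pair_def)
qed

lemma summable_inverse_fourth_powers: "summable (\<lambda>k. 2 / real (Suc k) ^ 4)"
proof -
  have "summable (\<lambda>k. inverse (real k ^ 4))"
    by (rule inverse_power_summable) simp
  then have "summable (\<lambda>k. 2 * inverse (real (Suc k) ^ 4))"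
    by (intro summable_mult) (subst summable_Suc_iff)
  then show ?thesis
    by (simp add: field_simps)
qed

lemma summable_shifted_pole_pair:
  assumes "0 \<le> t" "t \<le> pi"
  shows "summable (\<lambda>k. shifted_pole_pair k t)"
proof -
  have "summable (\<lambda>k. shifted_pole_pair (Suc k) t)"
    by (rule summable_comparison_test[OF _ summable_inverse_fourth_powers])
      (use shifted_pole_pair_Suc_bound[OF assms] in auto)
  then show ?thesis
    by (rule summable_Suc_iff[THEN iffD1])
qed

lemma shifted_pole_pair_reflect: "shifted_pole_pair k (pi - t) = shifted_pole_pair k t"
proof -
  have "pi - t + real k * pi = real (Suc k) * pi - t"
    "real (Suc k) * pi - (pi - t) = t + real k * pi"
    by (simp_all add: algebra_simps)
  then show ?thesis
    by (simp only: shifted_pole_pair_def add.commute)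
qed

lemma shifted_pole_pair_duplication:
  "shifted_pole_pair k (t / 2) + shifted_pole_pair k (t / 2 + pi / 2)
    = 16 * (shifted_pole_pair (2 * k) t + shifted_pole_pair (2 * k + 1) t)"
proof -
  have half: "1 / (x / 2) ^ 4 = 16 * (1 / x ^ 4)" for x :: real
    by (simp add: power_divide)
  \<comment> \<open>The pairs mix: \<open>t / 2\<close> supplies the first term of pair
    \<open>2 * k\<close> and the second of pair \<open>2 * k + 1\<close>, while
    \<open>t / 2 + pi / 2\<close> supplies the other two. The factor 16 is
    \<open>2^4\<close>.\<close>
  have e: "t / 2 + real k * pi = (t + real (2 * k) * pi) / 2"
    "real (Suc k) * pi - t / 2 = (real (Suc (2 * k + 1)) * pi - t) / 2"
    "t / 2 + pi / 2 + real k * pi = (t + real (2 * k + 1) * pi) / 2"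
    "real (Suc k) * pi - (t / 2 + pi / 2) = (real (Suc (2 * k)) * pi - t) / 2"
    by (simp_all add: field_simps)
  show ?thesis
    unfolding shifted_pole_pair_def e half by (simp add: algebra_simps)
qed

lemma suminf_shifted_pole_pair_duplication:
  assumes "0 < t" "t < pi"
  shows "(\<Sum>k. shifted_pole_pair k (t / 2)) + (\<Sum>k. shifted_pole_pair k (t / 2 + pi / 2))
    = 16 * (\<Sum>k. shifted_pole_pair k t)"
proof -
  have "(\<lambda>k. shifted_pole_pair k t) sums (\<Sum>k. shifted_pole_pair k t)"
    using assms by (intro summable_sums summable_shifted_pole_pair) auto
  then have "(\<lambda>n. \<Sum>k = n * 2..<n * 2 + 2. shifted_pole_pair k t) sums (\<Sum>k. shifted_pole_pair k t)"
    by (rule sums_group) simp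
  then have "(\<lambda>n. 16 * (\<Sum>k = n * 2..<n * 2 + 2. shifted_pole_pair k t))
      sums (16 * (\<Sum>k. shifted_pole_pair k t))"
    by (rule sums_mult)
  moreover have "16 * (\<Sum>k = n * 2..<n * 2 + 2. shifted_pole_pair k t)
      = shifted_pole_pair n (t / 2) + shifted_pole_pair n (t / 2 + pi / 2)" for n
    unfolding shifted_pole_pair_duplication by (simp add: mult.commute)
  moreover have "(\<lambda>n. shifted_pole_pair n (t / 2) + shifted_pole_pair n (t / 2 + pi / 2))
      sums ((\<Sum>k. shifted_pole_pair k (t / 2)) + (\<Sum>k. shifted_pole_pair k (t / 2 + pi / 2)))"
    using assms by (intro sums_add summable_sums summable_shifted_pole_pair) auto
  ultimately show ?thesis
    by (simp add: sums_unique2)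
qed

text \<open>The right side is one sixth of the second derivative of \<open>1 / sin^2 t\<close>, in
  accordance with the classical expansion of \<open>1 / sin^2 t\<close> into double poles;
  Herglotz's trick avoids differentiating a series.\<close>

lemma shifted_pole_pair_sums:
  assumes "0 < t" "t < pi"
  shows "(\<lambda>k. shifted_pole_pair k t) sums (1 / sin t ^ 4 - 2 / 3 * (1 / (sin t)\<^sup>2))"
proof -
  define A where "A t = (\<Sum>k. shifted_pole_pair k t)" for t
  define G where "G t = 1 / sin t ^ 4 - 2 / 3 * (1 / (sin t)\<^sup>2)" for t :: real
  define h where "h t = G t - A t" for t
  have reflect: "h (pi - t) = h t" for t
    by (simp add: h_def G_def A_def shifted_pole_pair_reflect)
  have dup: "h (t / 2) + h (t / 2 + pi / 2) = 16 * h t" if t: "0 < t" "t < pi" for t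
  proof -
    let ?s = "sin (t / 2)" and ?c = "cos (t / 2)"
    have pos: "0 < ?s" "0 < ?c"
      using t by (auto intro!: sin_gt_zero cos_gt_zero)
    have "1 / ?s\<^sup>2 + 1 / ?c\<^sup>2 = (?s\<^sup>2 + ?c\<^sup>2) / (?s\<^sup>2 * ?c\<^sup>2)"
      using pos by (simp add: field_simps del: sin_cos_squared_add sin_cos_squared_add2)
    then have csc2: "1 / ?s\<^sup>2 + 1 / ?c\<^sup>2 = 1 / (?s\<^sup>2 * ?c\<^sup>2)"
      by simp
    have csc4: "1 / ?s ^ 4 + 1 / ?c ^ 4 = (1 / ?s\<^sup>2 + 1 / ?c\<^sup>2)\<^sup>2 - 2 * (1 / (?s\<^sup>2 * ?c\<^sup>2))"
      by (simp add: power2_sum power_divide flip: power_mult)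
    have "sin t = 2 * ?s * ?c"
      using sin_double[of "t / 2"] by simp
    then have prod: "?s\<^sup>2 * ?c\<^sup>2 = (sin t)\<^sup>2 / 4"
      by (simp add: power_mult_distrib)
    \<comment> \<open>These two identities determine the coefficient:
      \<open>1 / sin^4 t - c / sin^2 t\<close> satisfies the duplication equation exactly when
      \<open>8 + 4 * c = 16 * c\<close>, that is \<open>c = 2/3\<close>.\<close>
    have "1 / ?s\<^sup>2 + 1 / ?c\<^sup>2 = 4 * (1 / (sin t)\<^sup>2)"
      "1 / ?s ^ 4 + 1 / ?c ^ 4 = 16 * (1 / sin t ^ 4) - 8 * (1 / (sin t)\<^sup>2)"
      unfolding csc4 csc2 prod by (simp_all add: power_divide flip: power_mult)
    moreover have "sin (t / 2 + pi / 2) = ?c"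
      by (simp add: sin_add)
    ultimately have "G (t / 2) + G (t / 2 + pi / 2) = 16 * G t"
      unfolding G_def by (simp only:) argo
    then show ?thesis
      using suminf_shifted_pole_pair_duplication[OF t] by (simp add: h_def A_def)
  qed
  \<comment> \<open>The summands bound, in order, the cancelled pole at 0, the term
    \<open>2/3\<close> of \<open>G\<close>, the pole at \<open>pi\<close>, and all remaining
    poles.\<close>
  define C where "C = 6 + 2 / 3 + (1 + (\<Sum>k. 2 / real (Suc k) ^ 4))"
  have half: "\<bar>h t\<bar> * (sin t)\<^sup>2 \<le> C" if t: "0 < t" "t \<le> pi / 2" for t
  proof -
    \<comment> \<open>All poles except the one at 0; on \<open>(0, pi/2]\<close> the nearest of them
      is at distance at least \<open>pi/2 \<ge> 1\<close>.\<close>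
    define R where "R = 1 / (pi - t) ^ 4 + (\<Sum>k. shifted_pole_pair (Suc k) t)"
    have t': "0 \<le> t" "t \<le> pi"
      using t by auto
    have s: "0 < sin t" "(sin t)\<^sup>2 \<le> 1"
      using t by (auto intro!: sin_gt_zero simp: abs_square_le_1)
    have sm: "summable (\<lambda>k. shifted_pole_pair (Suc k) t)"
      using summable_shifted_pole_pair[OF t'] by (rule summable_Suc_iff[THEN iffD2])
    have A: "A t = 1 / t ^ 4 + R"
      unfolding A_def R_def using suminf_split_head[OF summable_shifted_pole_pair[OF t']]
      by (simp add: shifted_pole_pair_def)
    have "1 \<le> (pi - t) ^ 4"
      using t pi_ge_two by (intro one_le_power) linarith
    then have "1 / (pi - t) ^ 4 \<le> 1"
      by (simp add: divide_le_eq)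
    moreover have "(\<Sum>k. shifted_pole_pair (Suc k) t) \<le> (\<Sum>k. 2 / real (Suc k) ^ 4)"
      by (intro suminf_le sm summable_inverse_fourth_powers shifted_pole_pair_Suc_bound t')
    moreover have "0 \<le> (\<Sum>k. shifted_pole_pair (Suc k) t)"
      by (intro suminf_nonneg sm shifted_pole_pair_Suc_bound t')
    ultimately have R: "0 \<le> R" "R \<le> 1 + (\<Sum>k. 2 / real (Suc k) ^ 4)"
      unfolding R_def by (auto intro: add_mono simp del: of_nat_Suc)
    have "\<bar>h t\<bar> * (sin t)\<^sup>2 = \<bar>h t * (sin t)\<^sup>2\<bar>"
      by (simp add: abs_mult)
    also have "h t * (sin t)\<^sup>2 = (1 / (sin t)\<^sup>2 - (sin t)\<^sup>2 / t ^ 4) - 2 / 3 - R * (sin t)\<^sup>2"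
      using s t by (simp add: h_def G_def A field_simps flip: power_add)
    also have "\<bar>\<dots>\<bar> \<le> C"
    proof -
      have "0 \<le> R * (sin t)\<^sup>2" "R * (sin t)\<^sup>2 \<le> R"
        using R s by (auto intro: mult_left_le)
      then show ?thesis
        using csc_squared_minus_bounded[OF t] R unfolding C_def abs_le_iff by linarith
    qed
    finally show ?thesis .
  qed
  \<comment> \<open>The symmetry about \<open>pi/2\<close> carries the bound to the other half, so
    the pole at \<open>pi\<close> needs no separate estimate.\<close>
  have "\<bar>h t\<bar> * (sin t)\<^sup>2 \<le> C" if "0 < t" "t < pi" for t
    using half[of t] half[of "pi - t"] that by (cases "t \<le> pi / 2") (auto simp: reflect)
  then have "h t = 0"
    using dyadic_functional_equation_imp_zero[of h C] dup assms by blast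
  then show ?thesis
    using summable_sums[OF summable_shifted_pole_pair, of t] assms by (simp add: h_def A_def G_def)
qed

lemma integral_reflect_shift_real:
  fixes g :: "real \<Rightarrow> 'a::real_normed_vector"
  shows "integral {a..b} (\<lambda>t. g (c - t)) = integral {c - b..c - a} g"
  using Henstock_Kurzweil_Integration.integral_reflect_real[of b a "\<lambda>t. g (c - t)"] integral_shift_real_ivl[of "c - b" c "c - a" g]
  by (simp add: add.commute)

section \<open>The continuous kernel and its folded pieces\<close>

definition sinc4 :: "real \<Rightarrow> real" where
  "sinc4 x = (if x = 0 then 1 else sin x ^ 4 / x ^ 4)"

lemma continuous_on_sinc4: "continuous_on A sinc4"
proof -
  have "isCont sinc4 x" for x
  proof (cases "x = 0")
    case True
    have "((\<lambda>x::real. sin x ^ 4 / x ^ 4) \<longlongrightarrow> 1) (at 0)"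
      by real_asymp
    then have "(sinc4 \<longlongrightarrow> 1) (at 0)"
      by (rule Lim_transform_eventually) (auto simp: eventually_at_filter sinc4_def)
    then show ?thesis
      using True by (simp add: isCont_def sinc4_def)
  next
    case False
    then have "isCont (\<lambda>x. sin x ^ 4 / x ^ 4) x"
      by (intro continuous_intros) auto
    moreover have "\<forall>\<^sub>F y in nhds x. sinc4 y = sin y ^ 4 / y ^ 4"
      using t1_space_nhds[OF False] by (rule eventually_mono) (simp add: sinc4_def)
    ultimately show ?thesis
      by (simp add: isCont_cong)
  qed
  then show ?thesis
    by (simp add: continuous_at_imp_continuous_on)
qed

lemma sinc4_bounds: "0 \<le> sinc4 x" "sinc4 x \<le> 1"
proof -
  have "\<bar>sin x\<bar> ^ 4 \<le> \<bar>x\<bar> ^ 4"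
    by (intro power_mono abs_sin_x_le_abs_x) auto
  then show "0 \<le> sinc4 x" "sinc4 x \<le> 1"
    by (simp_all add: sinc4_def divide_le_eq power_even_abs)
qed

text \<open>The kernel that \<open>[k pi, (k+1) pi]\<close> contributes after folding onto
  \<open>[0, pi/2]\<close>. Using \<open>sinc4\<close> keeps it continuous at \<open>t = 0\<close>,
  where \<open>sin t ^ 4 * shifted_pole_pair 0 t\<close> would be 0 instead of 1 by the convention
  for division by zero.\<close>

definition sinc4_pair :: "nat \<Rightarrow> real \<Rightarrow> real" where
  "sinc4_pair k t = sinc4 (t + real k * pi) + sinc4 (real (Suc k) * pi - t)"

lemma sin_fourth_shift:
  "sin (t + real k * pi) ^ 4 = sin t ^ 4" "sin (real k * pi - t) ^ 4 = sin t ^ 4"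
  by (simp_all add: sin_add sin_diff power_mult_distrib flip: power_mult)

lemma sinc4_pair_eq:
  assumes "0 < t" "t < pi"
  shows "sinc4_pair k t = sin t ^ 4 * shifted_pole_pair k t"
proof -
  have "0 \<le> real k * pi"
    by simp
  moreover have "real (Suc k) * pi = real k * pi + pi"
    by (simp add: algebra_simps)
  ultimately have "t + real k * pi \<noteq> 0" "real (Suc k) * pi - t \<noteq> 0"
    using assms by linarith+
  then show ?thesis
    by (simp add: sinc4_pair_def sinc4_def sin_fourth_shift shifted_pole_pair_def distrib_left
        del: of_nat_Suc)
qed

lemma sinc4_pair_0: "sinc4_pair k 0 = (if k = 0 then 1 else 0)"
  by (auto simp: sinc4_pair_def sinc4_def sin_npi simp del: of_nat_Suc)

text \<open>Inside the interval this is the partial fraction expansion times \<open>sin^4 t\<close>.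
  At \<open>t = 0\<close> the series reduces to its term of index 0.\<close>

lemma sinc4_pair_sums:
  assumes "0 \<le> t" "t < pi"
  shows "(\<lambda>k. sinc4_pair k t) sums (1 - 2 / 3 * (sin t)\<^sup>2)"
proof (cases "t = 0")
  case True
  then show ?thesis
    using sums_single[of 0 "\<lambda>_. 1::real"] by (simp add: sinc4_pair_0)
next
  case False
  then have t: "0 < t" "t < pi"
    using assms by auto
  then have "sin t \<noteq> 0"
    using sin_gt_zero by force
  then have "sin t ^ 4 * (1 / sin t ^ 4 - 2 / 3 * (1 / (sin t)\<^sup>2)) = 1 - 2 / 3 * (sin t)\<^sup>2"
    by (simp add: field_simps flip: power_add)
  then show ?thesis
    using sums_mult[OF shifted_pole_pair_sums[OF t], of "sin t ^ 4"] by (simp add: sinc4_pair_eq t)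
qed

lemma sinc4_pair_Suc_bound:
  assumes "0 \<le> t" "t < pi"
  shows "\<bar>sinc4_pair (Suc k) t\<bar> \<le> 2 / real (Suc k) ^ 4"
proof (cases "t = 0")
  case False
  then have "\<bar>sinc4_pair (Suc k) t\<bar> = sin t ^ 4 * shifted_pole_pair (Suc k) t"
    using assms shifted_pole_pair_Suc_bound(1)[of t k] by (simp add: sinc4_pair_eq)
  also have "\<dots> \<le> 1 * (2 / real (Suc k) ^ 4)"
    using assms shifted_pole_pair_Suc_bound[of t k]
    by (intro mult_mono power_le_one sin_ge_zero sin_le_one) auto
  finally show ?thesis
    by simp
qed (simp add: sinc4_pair_0)

section \<open>Folding the integral and passing to the limit\<close>

theorem theorem2:
  fixes f :: "real \<Rightarrow> real"
  assumes "continuous_on UNIV f"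
    and "\<And>x. 0 \<le> x \<Longrightarrow> f (x + pi) = f x"
    and "\<And>x. 0 \<le> x \<Longrightarrow> f (pi - x) = f x"
    and "improper_riemann_integrable (\<lambda>x. (if x = 0 then 1 else sin x ^ 4 / x ^ 4) * f x) 0"
  shows "improper_riemann_integral (\<lambda>x. (if x = 0 then 1 else sin x ^ 4 / x ^ 4) * f x) 0
       = integral {0..pi/2} f - 2/3 * integral {0..pi/2} (\<lambda>t. (sin t)\<^sup>2 * f t)"
proof -
  define g where "g x = sinc4 x * f x" for x
  define S where "S N t = (\<Sum>k<N. sinc4_pair k t) * f t" for N t
  have g_eq: "(\<lambda>x. (if x = 0 then 1 else sin x ^ 4 / x ^ 4) * f x) = g"
    by (simp add: g_def sinc4_def fun_eq_iff)
  have cont_f: "continuous_on A f" for A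
    using assms(1) continuous_on_subset by blast
  have int_g: "g integrable_on {a..b}" for a b
    unfolding g_def by (intro integrable_continuous_interval continuous_intros continuous_on_sinc4 cont_f)
  have cont_pair: "continuous_on A (sinc4_pair k)" for A k
    unfolding sinc4_pair_def
    by (intro continuous_intros continuous_on_compose2[OF continuous_on_sinc4[of UNIV]]) auto
  have cont_S: "continuous_on A (S N)" for A N
    unfolding S_def by (intro continuous_intros cont_pair cont_f)

  have f_shift: "f (t + real k * pi) = f t" if "0 \<le> t" for k t
  proof (induction k)
    case (Suc k)
    have "f (t + real (Suc k) * pi) = f ((t + real k * pi) + pi)"
      by (simp add: algebra_simps)
    also have "\<dots> = f t"
      using assms(2)[of "t + real k * pi"] that Suc.IH by simp
    finally show ?case .
  qed simp
  \<comment> \<open>\<open>f_shift\<close> is applied at \<open>pi - t\<close>, which must be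
    nonnegative; hence the restriction \<open>t \<le> pi\<close>.\<close>
  have f_reflect: "f (real (Suc k) * pi - t) = f t" if "0 \<le> t" "t \<le> pi" for k t
    using f_shift[of "pi - t" k] assms(3)[of t] that by (simp add: algebra_simps)

  \<comment> \<open>The period is cut at its midpoint \<open>?m\<close>; the left half is translated
    and the right half reflected onto \<open>[0, pi/2]\<close>.\<close>
  have period: "integral {real k * pi..real (Suc k) * pi} g
      = integral {0..pi/2} (\<lambda>t. sinc4_pair k t * f t)" for k
  proof -
    let ?m = "real k * pi + pi / 2"
    have m: "real (Suc k) * pi - pi / 2 = ?m"
      by (simp add: field_simps)
    have "integral {real k * pi..real (Suc k) * pi} g
        = integral {real k * pi..?m} g + integral {?m..real (Suc k) * pi} g"
      by (rule Henstock_Kurzweil_Integration.integral_combine[symmetric])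
        (auto simp: int_g algebra_simps)
    also have "integral {real k * pi..?m} g = integral {0..pi/2} (\<lambda>t. g (t + real k * pi))"
      using integral_shift_real_ivl[of "real k * pi" "real k * pi" ?m g] by simp
    also have "\<dots> = integral {0..pi/2} (\<lambda>t. sinc4 (t + real k * pi) * f t)"
      by (intro integral_cong) (simp add: g_def f_shift)
    also have "integral {?m..real (Suc k) * pi} g = integral {0..pi/2} (\<lambda>t. g (real (Suc k) * pi - t))"
      unfolding integral_reflect_shift_real m by simp
    also have "\<dots> = integral {0..pi/2} (\<lambda>t. sinc4 (real (Suc k) * pi - t) * f t)"
      by (intro integral_cong) (use pi_ge_zero in \<open>auto simp: g_def f_reflect simp del: of_nat_Suc\<close>)
    also have "integral {0..pi/2} (\<lambda>t. sinc4 (t + real k * pi) * f t)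
        + integral {0..pi/2} (\<lambda>t. sinc4 (real (Suc k) * pi - t) * f t)
        = integral {0..pi/2} (\<lambda>t. sinc4_pair k t * f t)"
      unfolding sinc4_pair_def distrib_right
      by (intro integral_add[symmetric] integrable_continuous_interval continuous_intros
          continuous_on_compose2[OF continuous_on_sinc4[of UNIV]] cont_f) auto
    finally show ?thesis .
  qed
  have partial: "integral {0..real N * pi} g = integral {0..pi/2} (S N)" for N
  proof (induction N)
    case 0
    then show ?case by (simp add: S_def)
  next
    case (Suc N)
    have "integral {0..real (Suc N) * pi} g
        = integral {0..real N * pi} g + integral {real N * pi..real (Suc N) * pi} g"
      by (rule Henstock_Kurzweil_Integration.integral_combine[symmetric])
        (auto simp: int_g)
    also have "\<dots> = integral {0..pi/2} (\<lambda>t. S N t + sinc4_pair N t * f t)"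
      unfolding Suc.IH period
      by (intro integral_add[symmetric] integrable_continuous_interval continuous_intros
          cont_S cont_pair cont_f)
    finally show ?case
      by (simp add: S_def[abs_def] distrib_right)
  qed

  have pihalf: "0 \<le> t \<Longrightarrow> t \<le> pi / 2 \<Longrightarrow> t < pi" for t
    using pi_gt_zero by linarith
  \<comment> \<open>The value 2 at index 0 comes from \<open>sinc4 \<le> 1\<close> for each of the
    two terms; the formula for the other indices would give 0 there.\<close>
  define M where "M k = (if k = 0 then 2 else 2 / real k ^ 4)" for k
  have "summable (\<lambda>k. M (Suc k))"
    unfolding M_def using summable_inverse_fourth_powers by simp
  then have "summable M"
    by (rule summable_Suc_iff[THEN iffD1])
  moreover have "norm (sinc4_pair k t) \<le> M k" if "t \<in> {0..pi/2}" for k t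
  proof (cases k)
    case 0
    then show ?thesis
      using sinc4_bounds[of "t"] sinc4_bounds[of "pi - t"] by (simp add: M_def sinc4_pair_def)
  next
    case (Suc j)
    then show ?thesis
      using sinc4_pair_Suc_bound[of t j] pihalf[of t] that by (simp add: M_def)
  qed
  ultimately have "uniform_limit {0..pi/2} (\<lambda>N t. \<Sum>k<N. sinc4_pair k t) (\<lambda>t. \<Sum>k. sinc4_pair k t) sequentially"
    by (intro Weierstrass_m_test) auto
  moreover have "(\<Sum>k. sinc4_pair k t) = 1 - 2 / 3 * (sin t)\<^sup>2" if "t \<in> {0..pi/2}" for t
    using sinc4_pair_sums[of t] pihalf[of t] that by (simp add: sums_iff)
  ultimately have "uniform_limit {0..pi/2} (\<lambda>N t. \<Sum>k<N. sinc4_pair k t) (\<lambda>t. 1 - 2 / 3 * (sin t)\<^sup>2) sequentially"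
    by (subst (asm) uniform_limit_cong'[where f = "\<lambda>N t. \<Sum>k<N. sinc4_pair k t"]) auto
  \<comment> \<open>Uniform convergence survives multiplication by \<open>f\<close> because
    \<open>f\<close> and the limit kernel are bounded on the compact interval.\<close>
  then have ul: "uniform_limit {0..pi/2} S (\<lambda>t. (1 - 2 / 3 * (sin t)\<^sup>2) * f t) sequentially"
    unfolding S_def
    by (intro uniform_lim_mult uniform_limit_const compact_imp_bounded compact_continuous_image
        continuous_intros cont_f compact_Icc)
  obtain I J where IJ: "\<And>N. (S N has_integral I N) {0..pi/2}"
    "((\<lambda>t. (1 - 2 / 3 * (sin t)\<^sup>2) * f t) has_integral J) {0..pi/2}" "I \<longlonglongrightarrow> J"
    using uniform_limit_integral[OF ul cont_S trivial_limit_sequentially] by blast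
  have "(\<lambda>N. integral {0..real N * pi} g) = I"
    using IJ(1) by (auto simp: partial integral_unique)
  with IJ have lim_J: "(\<lambda>N. integral {0..real N * pi} g) \<longlonglongrightarrow> J"
    by simp

  \<comment> \<open>The assumed integrability supplies a limit \<open>L\<close> over all real
    \<open>T\<close>; evaluating it along \<open>T = N pi\<close> identifies \<open>L\<close> with
    \<open>J\<close>.\<close>
  obtain L where L: "has_improper_riemann_integral g 0 L"
    using assms(4) by (auto simp: g_eq improper_riemann_integrable_def)
  then have "((\<lambda>T. integral {0..T} g) \<longlongrightarrow> L) at_top"
    by (simp add: has_improper_riemann_integral_def)
  moreover have "filterlim (\<lambda>N. real N * pi) at_top sequentially"
    by real_asymp
  ultimately have "(\<lambda>N. integral {0..real N * pi} g) \<longlonglongrightarrow> L"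
    by (rule filterlim_compose)
  then have "L = J"
    using lim_J LIMSEQ_unique by blast
  moreover have "J = integral {0..pi/2} (\<lambda>t. f t - 2 / 3 * ((sin t)\<^sup>2 * f t))"
    using IJ(2) by (simp add: algebra_simps integral_unique)
  moreover have "\<dots> = integral {0..pi/2} f - 2/3 * integral {0..pi/2} (\<lambda>t. (sin t)\<^sup>2 * f t)"
    by (subst integral_diff)
      (auto intro!: integrable_continuous_interval continuous_intros cont_f)
  ultimately show ?thesis
    unfolding g_eq using improper_riemann_integral_eqI[OF L] by simp
qed

end
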